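(* For every positive integer $a$ we have $$\sum_{k=0}^{3^a-1}(-2)^k\binom{2k}{k}\equiv 3^a\pmod{3^{a+1}},$$ $$\sum_{k=0}^{3^a-1}(-5)^k\binom{2k}{k}\equiv-3^a\pmod{3^{a+1}},$$ $$\sum_{k=0}^{7^a-1}(-5)^k\binom{2k}{k}\equiv 7^a\pmod{7^{a+1}}.$$ *)

theory Defs
  imports "HOL-Number_Theory.Number_Theory"
begin

end

theory Submission
  imports Defs
begin

text \<open>
  Put \<open>D = 1 - 4x\<close>. Expanding \<open>(4x)^k = (1 - D)^k\<close> in powers of \<open>D\<close>, the coefficients telescope and give
  \<open>4^n (\<Sum>k<n. x^k C(2k,k)) = 2n C(2n,n) (\<Sum>j<n. (-D)^j C(n-1,j) / (2j+1))\<close>.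
  Let \<open>p\<close> be an odd prime dividing \<open>D\<close> and let \<open>n = p^a\<close>. Then \<open>C(2n,n) \<equiv> 2\<close> and \<open>4^n \<equiv> 4\<close> modulo \<open>p\<close>,
  and on the right every term vanishes \<open>p\<close>-adically modulo \<open>p\<close> except the one for \<open>j = 0\<close> and, when
  \<open>p = 3\<close>, the one for \<open>j = 1\<close>, which is \<open>D/3\<close> modulo \<open>3\<close>.
\<close>

section \<open>Central binomial sums expanded in powers of 1 - 4x\<close>

lemma central_binomial_Suc:
  "real (Suc n) * real ((2 * Suc n) choose Suc n) = 2 * (2 * real n + 1) * real ((2 * n) choose n)"
proof -
  have "Suc n * ((2 * n + 2) choose Suc n) = (2 * n + 2) * ((2 * n + 1) choose n)"
    using Suc_times_binomial[of n "2 * n + 1"] by simp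
  moreover have "Suc n * ((2 * n + 1) choose n) = (2 * n + 1) * ((2 * n) choose n)"
    using binomial_absorb_comp[of "2 * n + 1" n] by simp
  ultimately have "Suc n * ((2 * n + 2) choose Suc n) = 2 * (2 * n + 1) * ((2 * n) choose n)"
    by (simp add: algebra_simps del: binomial_Suc_Suc)
  then have "real (Suc n * ((2 * n + 2) choose Suc n)) = real (2 * (2 * n + 1) * ((2 * n) choose n))"
    by (rule arg_cong)
  then show ?thesis
    by (simp del: binomial_Suc_Suc add: algebra_simps)
qed

text \<open>Subtraction in the reals avoids truncation: for k > n both binomials vanish, so the
  identity can rewrite inside sums without a side condition.\<close>

lemma binomial_absorb_comp_real:
  "(real n - real k) * real (n choose k) = real n * real ((n - 1) choose k)"
proof (cases "k \<le> n")
  case True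
  then show ?thesis
    using arg_cong[OF binomial_absorb_comp[of n k], of real] by (simp add: of_nat_diff)
qed (auto simp: binomial_eq_0)

text \<open>The right side is a discrete antiderivative of the summand: passing from n to n + 1
  increases it by exactly the n-th term.\<close>

lemma sum_central_binomial_choose:
  "(\<Sum>k<n. real ((2 * k) choose k) / 4 ^ k * real (k choose j))
    = 2 * (real n - real j) / (2 * real j + 1) * real (n choose j) * real ((2 * n) choose n) / 4 ^ n"
proof (induction n)
  case (Suc n)
  define b where "b = real ((2 * n) choose n) / 4 ^ n"
  define c where "c = real (n choose j)"
  have c: "(real (Suc n) - real j) * real (Suc n choose j) = real (Suc n) * c"
    using binomial_absorb_comp_real[of "Suc n" j] by (simp add: c_def)
  have b: "real (Suc n) * (real ((2 * Suc n) choose Suc n) / 4 ^ Suc n) = (2 * real n + 1) / 2 * b"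
    unfolding b_def times_divide_eq_right central_binomial_Suc by (simp add: field_simps)
  have "2 * (real (Suc n) - real j) / (2 * real j + 1) * real (Suc n choose j)
          * real ((2 * Suc n) choose Suc n) / 4 ^ Suc n
      = 2 / (2 * real j + 1) * ((real (Suc n) - real j) * real (Suc n choose j))
          * (real ((2 * Suc n) choose Suc n) / 4 ^ Suc n)"
    by (simp only: times_divide_eq_left times_divide_eq_right mult.assoc)
  also have "\<dots> = 2 / (2 * real j + 1) * c
      * (real (Suc n) * (real ((2 * Suc n) choose Suc n) / 4 ^ Suc n))"
    unfolding c by (simp only: mult_ac)
  also have "\<dots> = 2 / (2 * real j + 1) * c * ((2 * real n + 1) / 2 * b)"
    unfolding b ..
  \<comment> \<open>The split 2n + 1 = 2(n - j) + (2j + 1) separates the old value from the new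
    summand.\<close>
  also have "\<dots> = 2 * (real n - real j) / (2 * real j + 1) * c * b + b * c"
    by (simp add: divide_simps) (simp add: algebra_simps)
  finally show ?case
    using Suc.IH by (simp add: b_def c_def)
qed auto

lemma sum_central_binomial_expansion:
  fixes x D :: real
  assumes D: "D = 1 - 4 * x"
  shows "4 ^ n * (\<Sum>k<n. x ^ k * real ((2 * k) choose k))
    = 2 * real n * real ((2 * n) choose n)
        * (\<Sum>j<n. (- D) ^ j * real ((n - 1) choose j) / (2 * real j + 1))"
proof -
  let ?b = "\<lambda>k. real ((2 * k) choose k) / 4 ^ k"
  \<comment> \<open>Padding the expansion with zero terms up to n gives a range independent of k, so
    the two sums can be swapped.\<close>
  have pow: "(1 - D) ^ k = (\<Sum>j<n. (- D) ^ j * real (k choose j))" if "k < n" for k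
  proof -
    have "(1 - D) ^ k = (\<Sum>j\<le>k. real (k choose j) * (- D) ^ j)"
      using binomial_ring[of "- D" 1 k] by simp
    also have "\<dots> = (\<Sum>j<n. real (k choose j) * (- D) ^ j)"
      using that by (intro sum.mono_neutral_left) (auto simp: binomial_eq_0)
    finally show ?thesis
      by (simp add: mult.commute)
  qed
  have "(\<Sum>k<n. x ^ k * real ((2 * k) choose k)) = (\<Sum>k<n. ?b k * (1 - D) ^ k)"
    by (simp add: D power_mult_distrib mult.commute)
  also have "\<dots> = (\<Sum>k<n. \<Sum>j<n. (- D) ^ j * (?b k * real (k choose j)))"
    by (intro sum.cong refl) (simp add: pow sum_distrib_left sum_divide_distrib mult_ac)
  also have "\<dots> = (\<Sum>j<n. (- D) ^ j * (\<Sum>k<n. ?b k * real (k choose j)))"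
    by (subst sum.swap) (simp add: sum_distrib_left)
  also have "4 ^ n * \<dots> = (\<Sum>j<n. 2 * real ((2 * n) choose n) *
      ((- D) ^ j * ((real n - real j) * real (n choose j)) / (2 * real j + 1)))"
    unfolding sum_central_binomial_choose sum_distrib_left
    by (intro sum.cong refl) simp
  \<comment> \<open>Absorption turns (n - j) C(n,j) into n C(n-1,j); this pulls out the factor n,
    later p^a.\<close>
  also have "\<dots> = 2 * real n * real ((2 * n) choose n)
        * (\<Sum>j<n. (- D) ^ j * real ((n - 1) choose j) / (2 * real j + 1))"
    unfolding binomial_absorb_comp_real sum_distrib_left
    by (intro sum.cong refl) simp
  finally show ?thesis .
qed

section \<open>Divisibility by p in the localisation at p\<close>

text \<open>For prime \<open>p\<close>: the real number \<open>r\<close> lies in the ideal generated by \<open>p\<close> of the localisation of the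
  integers at \<open>p\<close>.\<close>
definition locally_multiple :: "nat \<Rightarrow> real \<Rightarrow> bool" where
  "locally_multiple p r \<longleftrightarrow>
    (\<exists>u v :: int. \<not> int p dvd v \<and> real_of_int v * r = real p * real_of_int u)"

lemma locally_multiple_of_int: "prime p \<Longrightarrow> locally_multiple p (real p * real_of_int u)"
  unfolding locally_multiple_def
  by (rule exI[of _ u], rule exI[of _ 1]) (auto dest: prime_gt_1_nat)

lemma locally_multiple_add:
  assumes "prime p" "locally_multiple p r" "locally_multiple p s"
  shows "locally_multiple p (r + s)"
proof -
  obtain u v where uv: "\<not> int p dvd v" "real_of_int v * r = real p * real_of_int u"
    using assms(2) unfolding locally_multiple_def by blast
  obtain u' v' where uv': "\<not> int p dvd v'" "real_of_int v' * s = real p * real_of_int u'"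
    using assms(3) unfolding locally_multiple_def by blast
  have "\<not> int p dvd v * v'"
    using uv(1) uv'(1) assms(1) by (simp add: prime_dvd_mult_iff)
  moreover have "real_of_int (v * v') * (r + s)
      = real_of_int v' * (real_of_int v * r) + real_of_int v * (real_of_int v' * s)"
    by (simp add: algebra_simps)
  then have "real_of_int (v * v') * (r + s) = real p * real_of_int (v' * u + v * u')"
    unfolding uv(2) uv'(2) by (simp add: algebra_simps)
  ultimately show ?thesis
    unfolding locally_multiple_def by blast
qed

lemma locally_multiple_sum:
  assumes "prime p" "\<And>i. i \<in> A \<Longrightarrow> locally_multiple p (f i)"
  shows "locally_multiple p (\<Sum>i\<in>A. f i)"
  using assms(2)
proof (induction A rule: infinite_finite_induct)
  case (insert i A)
  then show ?case
    by (simp add: locally_multiple_add[OF assms(1)])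
qed (use locally_multiple_of_int[OF assms(1), of 0] in simp_all)

text \<open>This bounds the power of p in the denominator 2j + 1. The case p = 3, j = 1 is excluded
  because there 2j + 1 = p^j.\<close>

lemma odd_less_power:
  fixes p j :: nat
  assumes "p \<ge> 3" "j \<ge> 1" "p = 3 \<Longrightarrow> j \<ge> 2"
  shows "2 * j + 1 < p ^ j"
proof -
  \<comment> \<open>One step multiplies the right side by at least 3 and the left side by at most 3,
    so only the base case matters: j = 2 for p = 3, and j = 1 otherwise.\<close>
  have grow: "2 * Suc i + 1 < p ^ Suc i" if "2 * i + 1 < p ^ i" for i
  proof -
    have "2 * Suc i + 1 \<le> 3 * (2 * i + 1)"
      by simp
    also have "\<dots> < 3 * p ^ i"
      using that by simp
    also have "\<dots> \<le> p ^ Suc i"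
      using assms(1) by simp
    finally show ?thesis .
  qed
  show ?thesis
  proof (cases "p = 3")
    case True
    from assms(3)[OF True] show ?thesis
    proof (induction j rule: dec_induct)
      case base
      show ?case
        using True by simp
    next
      case (step i)
      show ?case
        by (rule grow) (rule step.IH)
    qed
  next
    case False
    from assms(2) show ?thesis
    proof (induction j rule: dec_induct)
      case base
      show ?case
        using False assms(1) by simp
    next
      case (step i)
      show ?case
        by (rule grow) (rule step.IH)
    qed
  qed
qed

text \<open>If p^e exactly divides 2j + 1, then p^e < p^j, so cancelling leaves at least one p in
  the numerator and a denominator prime to p.\<close>

lemma locally_multiple_term:
  fixes E c :: int
  assumes p: "prime p" "p \<ge> 3" and j: "j \<ge> 1" "p = 3 \<Longrightarrow> j \<ge> 2"
  shows "locally_multiple p ((real p * E) ^ j * c / (2 * real j + 1))"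
proof -
  obtain m where m: "2 * j + 1 = p ^ multiplicity p (2 * j + 1) * m" "\<not> p dvd m"
    using multiplicity_decompose'[of "2 * j + 1" p] p by auto
  define e where "e = multiplicity p (2 * j + 1)"
  have "p ^ e \<le> 2 * j + 1"
    by (intro dvd_imp_le) (simp_all add: e_def multiplicity_dvd)
  with odd_less_power[OF p(2) j] have "p ^ e < p ^ j"
    by linarith
  then have "e < j"
    using p(2) by (simp add: power_strict_increasing_iff)
  then obtain d where d: "j = e + Suc d"
    using less_iff_Suc_add by auto
  have "real (2 * j + 1) = real (p ^ e * m)"
    using m(1) unfolding e_def by (rule arg_cong)
  then have den: "2 * real j + 1 = real p ^ e * real m"
    by simp
  have "m \<noteq> 0"
    using m(2) by (metis dvd_0_right)
  have "\<not> int p dvd int m"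
    using m(2) by simp
  moreover have "real_of_int (int m) * ((real p * E) ^ j * c / (2 * real j + 1))
      = real p * real_of_int (int p ^ d * E ^ j * c)"
    unfolding den using p(2) \<open>m \<noteq> 0\<close>
    by (simp add: d power_add power_mult_distrib)
  ultimately show ?thesis
    unfolding locally_multiple_def by blast
qed

section \<open>Binomial coefficients and powers modulo p\<close>

text \<open>Since k C(p^a,k) is a multiple of p^a, a binomial prime to p would force p^a to divide
  k, which is too small.\<close>

lemma prime_dvd_prime_power_choose:
  fixes p :: nat
  assumes "prime p" "0 < k" "k < p ^ a"
  shows "p dvd (p ^ a choose k)"
proof (rule ccontr)
  assume "\<not> p dvd (p ^ a choose k)"
  then have "coprime (p ^ a) (p ^ a choose k)"
    using assms(1) by (simp add: prime_imp_coprime)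
  moreover have "k * (p ^ a choose k) = p ^ a * ((p ^ a - 1) choose (k - 1))"
    using times_binomial_minus1_eq[OF assms(2)] .
  then have "p ^ a dvd k * (p ^ a choose k)"
    by simp
  ultimately have "p ^ a dvd k"
    by (simp add: coprime_dvd_mult_left_iff)
  with assms(2,3) show False
    by (auto dest: dvd_imp_le)
qed

text \<open>C(2n,n) is the sum of the squares C(n,k)^2, and for n = p^a only k = 0 and k = n survive
  modulo p.\<close>

lemma central_binomial_prime_power_cong:
  assumes "prime p"
  shows "[int ((2 * p ^ a) choose (p ^ a)) = 2] (mod int p)"
proof -
  let ?n = "p ^ a"
  have n: "?n > 0"
    using assms by (simp add: prime_gt_0_nat)
  have "[(\<Sum>k\<le>?n. int (?n choose k) ^ 2) = (\<Sum>k\<le>?n. if k \<in> {0, ?n} then 1 else 0)] (mod int p)"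
  proof (rule cong_sum)
    fix k
    assume "k \<in> {..?n}"
    then consider "k = 0 \<or> k = ?n" | "0 < k" "k < ?n"
      by fastforce
    then show "[int (?n choose k) ^ 2 = (if k \<in> {0, ?n} then 1 else 0)] (mod int p)"
    proof cases
      case 2
      then have "int p dvd int (?n choose k)"
        using prime_dvd_prime_power_choose[OF assms] by simp
      with 2 show ?thesis
        by (simp add: cong_0_iff power2_eq_square)
    qed auto
  qed
  also have "(\<Sum>k\<le>?n. if k \<in> {0, ?n} then 1 else 0 :: int) = (\<Sum>k\<in>{0, ?n}. 1)"
    by (rule sum.mono_neutral_cong_right) auto
  also have "\<dots> = 2"
    using n by auto
  also have "(\<Sum>k\<le>?n. int (?n choose k) ^ 2) = int ((2 * ?n) choose ?n)"
    by (simp flip: choose_square_sum)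
  finally show ?thesis .
qed

lemma power_prime_power_cong:
  fixes p c :: nat
  assumes "prime p"
  shows "[c ^ (p ^ a) = c] (mod p)"
proof -
  have *: "[c ^ p = c] (mod p)"
  proof (cases "p dvd c")
    case True
    then have "[c = 0] (mod p)" "[c ^ p = 0] (mod p)"
      using assms by (auto simp: cong_0_iff prime_gt_0_nat intro: dvd_trans[OF _ dvd_power])
    then show ?thesis
      by (metis cong_sym cong_trans)
  next
    case False
    from cong_scalar_left[OF fermat_theorem[OF assms False], of c] show ?thesis
      using assms by (simp add: power_eq_if[of c p] prime_gt_0_nat)
  qed
  show ?thesis
  proof (induction a)
    case (Suc a)
    from cong_pow[OF Suc.IH, of p] show ?case
      using * by (metis cong_trans power_Suc2 power_mult)
  qed simp
qed

section \<open>The congruence modulo p^(a+1) for general x\<close>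

text \<open>\<open>q\<close> collects the surviving terms: 1 from j = 0 and, for p = 3,
  \<open>E\<close> = (1 - 4x)/3 from j = 1.\<close>

lemma sum_central_binomial_prime_power_cong:
  fixes x E :: int
  assumes p: "prime p" "p \<ge> 3" and a: "a > 0" and E: "1 - 4 * x = int p * E"
  defines "q \<equiv> if p = 3 then 1 + E else 1"
  shows "[(\<Sum>k = 0..p ^ a - 1. x ^ k * int ((2 * k) choose k)) = q * int p ^ a] (mod int p ^ (a + 1))"
proof -
  define n where "n = p ^ a"
  define S where "S = (\<Sum>k<n. x ^ k * int ((2 * k) choose k))"
  define B where "B = int ((2 * n) choose n)"
  define f where "f = (\<lambda>j. (- (real p * E)) ^ j * real ((n - 1) choose j) / (2 * real j + 1))"
  \<comment> \<open>\<open>h j\<close> is the residue of \<open>f j\<close> modulo p, in the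
    localised sense.\<close>
  define h where "h = (\<lambda>j::nat. if j = 0 then 1 else if p = 3 \<and> j = 1 then real_of_int E else 0)"
  have n: "n \<ge> 3" "p dvd n"
    using p a self_le_power[of p a] by (auto simp: n_def)

  have "1 - 4 * real_of_int x = real_of_int (1 - 4 * x)"
    by simp
  also have "\<dots> = real p * E"
    by (simp add: E)
  finally have expansion: "4 ^ n * real_of_int S = 2 * real n * real_of_int B * (\<Sum>j<n. f j)"
    using sum_central_binomial_expansion[of "real p * E" "real_of_int x" n]
    by (simp add: S_def B_def f_def)

  have "locally_multiple p (f j - h j)" for j
  proof -
    consider "j = 0" | "p = 3" "j = 1" | "j \<ge> 1" "p = 3 \<Longrightarrow> j \<ge> 2"
      by linarith
    then show ?thesis
    proof cases
      case 1
      then show ?thesis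
        using locally_multiple_of_int[OF p(1), of 0] by (simp add: f_def h_def)
    next
      case 2
      obtain m where "n = p * m"
        using n(2) by auto
      \<comment> \<open>Here \<open>f j\<close> = -3E(n - 1)/3 = E - nE.\<close>
      moreover have "f j - h j = - (real n * E)"
        using 2 n(1) by (simp add: f_def h_def of_nat_diff field_simps)
      ultimately have "f j - h j = real p * real_of_int (- int m * E)"
        by simp
      then show ?thesis
        using locally_multiple_of_int[OF p(1)] by metis
    next
      case 3
      then have "h j = 0"
        by (auto simp: h_def)
      moreover have "locally_multiple p
          ((real p * real_of_int (- E)) ^ j * real_of_int (int ((n - 1) choose j)) / (2 * real j + 1))"
        using locally_multiple_term[OF p 3] .
      ultimately show ?thesis
        by (simp add: f_def)
    qed
  qed
  then have "locally_multiple p (\<Sum>j<n. f j - h j)"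
    by (intro locally_multiple_sum p(1))
  moreover have "(\<Sum>j<n. h j) = (\<Sum>j\<in>{0, 1}. h j)"
    using n(1) by (intro sum.mono_neutral_right) (auto simp: h_def)
  then have "(\<Sum>j<n. h j) = q"
    by (simp add: h_def q_def)
  ultimately have "locally_multiple p ((\<Sum>j<n. f j) - q)"
    by (simp add: sum_subtractf)
  then obtain u v where v: "\<not> int p dvd v" and uv: "v * ((\<Sum>j<n. f j) - q) = real p * real_of_int u"
    unfolding locally_multiple_def by blast

  \<comment> \<open>Multiplying by the denominator \<open>v\<close> yields an integer identity;
    \<open>v\<close> is prime to p and is cancelled afterwards.\<close>
  have "real_of_int (v * (4 ^ n * S - 2 * int n * B * q))
      = v * (4 ^ n * real_of_int S) - v * (2 * real n * B * q)"
    by (simp add: algebra_simps)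
  also have "\<dots> = 2 * real n * B * (v * ((\<Sum>j<n. f j) - q))"
    unfolding expansion by (simp add: algebra_simps)
  also have "\<dots> = real_of_int (int n * int p * (2 * B * u))"
    unfolding uv by simp
  finally have "v * (4 ^ n * S - 2 * int n * B * q) = int n * int p * (2 * B * u)"
    using of_int_eq_iff by blast
  then have "int p ^ (a + 1) dvd v * (4 ^ n * S - 2 * int n * B * q)"
    by (simp add: n_def)
  moreover have "coprime (int p ^ (a + 1)) v"
    using v p(1) by (intro coprime_power_left_iff[THEN iffD2] disjI1 prime_imp_coprime) auto
  ultimately have cong: "int p ^ (a + 1) dvd 4 ^ n * S - 2 * int n * B * q"
    by (simp only: coprime_dvd_mult_right_iff)

  have "\<not> p dvd 2"
    using p(2) by (auto dest: dvd_imp_le)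
  then have "\<not> p dvd 2 ^ 2"
    using p(1) prime_dvd_power by blast
  then have "coprime (int p) (int 4)"
    using p(1) by (subst coprime_int_iff) (simp add: prime_imp_coprime)
  then have coprime4: "coprime (int p) 4"
    by simp
  have "[4 ^ n * S = 2 * int n * B * q] (mod int p ^ (a + 1))"
    using cong by (simp add: cong_iff_dvd_diff)
  \<comment> \<open>Both 2B and 4^n are 4 modulo p only; the common factor n = p^a lifts this to
    modulus p^(a+1).\<close>
  moreover have "[2 * int n * B * q = 4 ^ n * (int n * q)] (mod int p ^ (a + 1))"
  proof -
    have "[B = 2] (mod int p)"
      using central_binomial_prime_power_cong[OF p(1)] by (simp add: B_def n_def)
    then have "[2 * B = 2 * 2] (mod int p)"
      by (rule cong_scalar_left)
    moreover have "[int (4 ^ n) = int 4] (mod int p)"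
      using power_prime_power_cong[OF p(1), of 4 a] unfolding n_def cong_int_iff .
    ultimately have "[2 * B = 4 ^ n] (mod int p)"
      by (simp add: cong_def)
    then have "int n * int p dvd int n * (2 * B - 4 ^ n)"
      by (simp add: cong_iff_dvd_diff)
    then have "int n * int p dvd int n * (2 * B - 4 ^ n) * q"
      by (rule dvd_mult2)
    then show ?thesis
      by (simp add: cong_iff_dvd_diff n_def algebra_simps)
  qed
  ultimately have "[4 ^ n * S = 4 ^ n * (int n * q)] (mod int p ^ (a + 1))"
    by (rule cong_trans)
  moreover have "coprime (4 ^ n) (int p ^ (a + 1))"
    using coprime4 by (simp add: coprime_commute)
  ultimately have "[S = int n * q] (mod int p ^ (a + 1))"
    by (simp only: cong_mult_lcancel)
  moreover have "{0..p ^ a - 1} = {..<n}"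
    using n(1) unfolding n_def by auto
  ultimately show ?thesis
    by (simp add: S_def n_def mult.commute)
qed

section \<open>The cases x = -2 and x = -5\<close>

theorem corollary1p4:
  fixes a :: nat
  assumes "a > 0"
  shows "[(\<Sum>k=0..3 ^ a - 1. (-2) ^ k * int ((2 * k) choose k)) = 3 ^ a] (mod (3 ^ (a + 1)))
         \<and> [(\<Sum>k=0..3 ^ a - 1. (-5) ^ k * int ((2 * k) choose k)) = - (3 ^ a)] (mod (3 ^ (a + 1)))
         \<and> [(\<Sum>k=0..7 ^ a - 1. (-5) ^ k * int ((2 * k) choose k)) = 7 ^ a] (mod (7 ^ (a + 1)))"
proof (intro conjI)
  \<comment> \<open>The coefficient of 3^a matters only modulo 3.\<close>
  have reduce: "[S = d * 3 ^ a] (mod 3 ^ (a + 1))"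
    if "[S = c * 3 ^ a] (mod 3 ^ (a + 1))" "[c = d] (mod 3)" for S c d :: int
  proof -
    have "3 * 3 ^ a dvd (c - d) * 3 ^ a"
      using that(2) unfolding cong_iff_dvd_diff by (rule mult_dvd_mono) simp
    then have "[c * 3 ^ a = d * 3 ^ a] (mod 3 ^ (a + 1))"
      by (simp add: cong_iff_dvd_diff left_diff_distrib)
    with that(1) show ?thesis
      by (rule cong_trans)
  qed
  \<comment> \<open>1 - 4x = 9 = 3 * 3, so \<open>q\<close> = 1 + 3 = 4, which is 1 modulo
    3.\<close>
  have "[(\<Sum>k=0..3 ^ a - 1. (-2) ^ k * int ((2 * k) choose k)) = 4 * 3 ^ a] (mod (3 ^ (a + 1)))"
    using sum_central_binomial_prime_power_cong[of 3 a "-2" 3] assms by simp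
  from reduce[OF this, of 1]
  show "[(\<Sum>k=0..3 ^ a - 1. (-2) ^ k * int ((2 * k) choose k)) = 3 ^ a] (mod (3 ^ (a + 1)))"
    by (simp add: cong_def)
  \<comment> \<open>1 - 4x = 21 = 3 * 7, so \<open>q\<close> = 1 + 7 = 8, which is -1 modulo
    3.\<close>
  have "[(\<Sum>k=0..3 ^ a - 1. (-5) ^ k * int ((2 * k) choose k)) = 8 * 3 ^ a] (mod (3 ^ (a + 1)))"
    using sum_central_binomial_prime_power_cong[of 3 a "-5" 7] assms by simp
  from reduce[OF this, of "-1"]
  show "[(\<Sum>k=0..3 ^ a - 1. (-5) ^ k * int ((2 * k) choose k)) = - (3 ^ a)] (mod (3 ^ (a + 1)))"
    by (simp add: cong_def)
  \<comment> \<open>Now 21 = 7 * 3 is read with p = 7, where \<open>q\<close> = 1.\<close>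
  have "prime (7 :: nat)"
    by simp
  then show "[(\<Sum>k=0..7 ^ a - 1. (-5) ^ k * int ((2 * k) choose k)) = 7 ^ a] (mod (7 ^ (a + 1)))"
    using sum_central_binomial_prime_power_cong[of 7 a "-5" 3] assms by simp
qed

end
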